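(* Let $G=G_1\nabla^2 G_2$ be a Haj\'os $2$-join of two disjoint non-empty graphs $G_1$ and $G_2$. Then: (a) if $\chi_2(G_1)=\chi_2(G_2)=k$ and $k\ge3$, then $\chi_2(G)=k$; (b) if both $G_1$ and $G_2$ belong to ${\rm Cri}_2(k)$ and $k\ge3$, then $G$ belongs to ${\rm Cri}_2(k)$.
   Context: All graphs are finite, undirected, loopless, and may have multiple edges. Hajós $2$-join: let $G_1,G_2$ be disjoint graphs and for $i\in\{1,2\}$ let $u_i,v_i$ be distinct vertices of $G_i$ and $E_i$ a set of two edges of $G_i$ joining $u_i$ and $v_i$. The graph $G_1\nabla^2 G_2$ is obtained from $G_1\cup G_2$ by deleting $E_1$ and $E_2$, identifying $v_1$ with $v_2$, and adding two new parallel edges between $u_1$ and $u_2$. $\chi_2(G)$ is the least $k\ge0$ such that $V(G)$ can be colored with $k$ colors so that each color class induces a forest (two parallel edges form a cycle). $G$ is $\chi_2$-critical if $\chi_2(G')<\chi_2(G)$ for every proper subgraph $G'$; ${\rm Cri}_2(k)$ is the class of $\chi_2$-critical graphs with $\chi_2=k$. *)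

theory Defs
  imports Main
begin

record ('v, 'e) mgraph =
  verts :: "'v set"
  edges :: "'e set"
  ends :: "'e \<Rightarrow> 'v set"

(* The values of ends outside edges are irrelevant. *)
definition multigraph :: "('v, 'e) mgraph \<Rightarrow> bool" where
  "multigraph G \<longleftrightarrow> finite (verts G) \<and> finite (edges G) \<and>
     (\<forall>e \<in> edges G. ends G e \<subseteq> verts G \<and> card (ends G e) = 2)"

definition subgraph :: "('v, 'e) mgraph \<Rightarrow> ('v, 'e) mgraph \<Rightarrow> bool" where
  "subgraph H G \<longleftrightarrow> multigraph H \<and> verts H \<subseteq> verts G \<and> edges H \<subseteq> edges G \<and>
     (\<forall>e \<in> edges H. ends H e = ends G e)"

definition proper_subgraph :: "('v, 'e) mgraph \<Rightarrow> ('v, 'e) mgraph \<Rightarrow> bool" where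
  "proper_subgraph H G \<longleftrightarrow>
     subgraph H G \<and> (verts H \<noteq> verts G \<or> edges H \<noteq> edges G)"

definition induced_subgraph :: "('v, 'e) mgraph \<Rightarrow> 'v set \<Rightarrow> ('v, 'e) mgraph" where
  "induced_subgraph G X =
     \<lparr>verts = verts G \<inter> X, edges = {e \<in> edges G. ends G e \<subseteq> X}, ends = ends G\<rparr>"

(* A cycle is given by its vertices and its edges in cyclic order. Distinctness of
   the edges matters only for length 2, where it asks for two parallel edges. *)
definition is_cycle :: "('v, 'e) mgraph \<Rightarrow> 'v list \<Rightarrow> 'e list \<Rightarrow> bool" where
  "is_cycle G vs es \<longleftrightarrow> length vs \<ge> 2 \<and> length es = length vs \<and>
     distinct vs \<and> distinct es \<and> set vs \<subseteq> verts G \<and> set es \<subseteq> edges G \<and>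
     (\<forall>i < length vs. ends G (es ! i) = {vs ! i, vs ! (Suc i mod length vs)})"

definition forest :: "('v, 'e) mgraph \<Rightarrow> bool" where
  "forest G \<longleftrightarrow> (\<nexists>vs es. is_cycle G vs es)"

definition forest_coloring :: "('v, 'e) mgraph \<Rightarrow> nat \<Rightarrow> ('v \<Rightarrow> nat) \<Rightarrow> bool" where
  "forest_coloring G k c \<longleftrightarrow> (\<forall>v \<in> verts G. c v < k) \<and>
     (\<forall>i < k. forest (induced_subgraph G {v \<in> verts G. c v = i}))"

definition chi2 :: "('v, 'e) mgraph \<Rightarrow> nat" where
  "chi2 G = (LEAST k. \<exists>c. forest_coloring G k c)"

definition chi2_critical :: "('v, 'e) mgraph \<Rightarrow> bool" where
  "chi2_critical G \<longleftrightarrow> multigraph G \<and> (\<forall>H. proper_subgraph H G \<longrightarrow> chi2 H < chi2 G)"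

definition Cri2 :: "nat \<Rightarrow> ('v, 'e) mgraph set" where
  "Cri2 k = {G. chi2_critical G \<and> chi2 G = k}"

definition disjoint_graphs :: "('v, 'e) mgraph \<Rightarrow> ('v, 'e) mgraph \<Rightarrow> bool" where
  "disjoint_graphs G H \<longleftrightarrow> verts G \<inter> verts H = {} \<and> edges G \<inter> edges H = {}"

definition graph_union :: "('v, 'e) mgraph \<Rightarrow> ('v, 'e) mgraph \<Rightarrow> ('v, 'e) mgraph" where
  "graph_union G H =
     \<lparr>verts = verts G \<union> verts H, edges = edges G \<union> edges H,
      ends = (\<lambda>e. if e \<in> edges G then ends G e else ends H e)\<rparr>"

definition delete_edges :: "('v, 'e) mgraph \<Rightarrow> 'e set \<Rightarrow> ('v, 'e) mgraph" where
  "delete_edges G F = G\<lparr>edges := edges G - F\<rparr>"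

(* The vertex obtained from v and w keeps the name v. *)
definition identify :: "('v, 'e) mgraph \<Rightarrow> 'v \<Rightarrow> 'v \<Rightarrow> ('v, 'e) mgraph" where
  "identify G v w = (let f = (\<lambda>x. if x = w then v else x) in
     \<lparr>verts = f ` verts G, edges = edges G, ends = (\<lambda>e. f ` ends G e)\<rparr>)"

definition add_edges :: "('v, 'e) mgraph \<Rightarrow> 'e set \<Rightarrow> 'v \<Rightarrow> 'v \<Rightarrow> ('v, 'e) mgraph" where
  "add_edges G F u w =
     \<lparr>verts = verts G, edges = edges G \<union> F,
      ends = (\<lambda>e. if e \<in> F then {u, w} else ends G e)\<rparr>"

definition two_parallel_edges :: "('v, 'e) mgraph \<Rightarrow> 'v \<Rightarrow> 'v \<Rightarrow> 'e set \<Rightarrow> bool" where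
  "two_parallel_edges G u v F \<longleftrightarrow> u \<in> verts G \<and> v \<in> verts G \<and> u \<noteq> v \<and>
     F \<subseteq> edges G \<and> card F = 2 \<and> (\<forall>e \<in> F. ends G e = {u, v})"

(* F consists of the two new edges; their names are arbitrary but fresh. *)
definition hajos_2_join :: "('v, 'e) mgraph \<Rightarrow> ('v, 'e) mgraph \<Rightarrow> ('v, 'e) mgraph \<Rightarrow> bool" where
  "hajos_2_join G1 G2 G \<longleftrightarrow>
     multigraph G1 \<and> multigraph G2 \<and> disjoint_graphs G1 G2 \<and>
     (\<exists>u1 v1 E1 u2 v2 E2 F.
        two_parallel_edges G1 u1 v1 E1 \<and> two_parallel_edges G2 u2 v2 E2 \<and>
        card F = 2 \<and> F \<inter> (edges G1 \<union> edges G2) = {} \<and>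
        G = add_edges (identify (delete_edges (graph_union G1 G2) (E1 \<union> E2)) v1 v2) F u1 u2)"

end

theory Submission
  imports Defs "HOL-Combinatorics.Transposition"
begin

text \<open>A set of edges contains a cycle iff it has a non-empty subset in which all degrees are even.
  Thus a coloring splits a graph into forests iff no non-empty set of monochromatic edges is even,
  and even sets restrict well: if two graphs share only the vertex \<open>v\<close>, the part of an even set in
  either graph is again even, because the only degree in doubt, that of \<open>v\<close>, is settled by the
  handshake lemma.

  The parallel edges \<open>E1\<close> force \<open>u1\<close> and \<open>v\<close> to get different colors, and conversely, if they do,
  \<open>E1\<close> can be added to any coloring for free. In a coloring of the join the two new edges make the
  colors of \<open>u1\<close> and \<open>u2\<close> differ, so one of them differs from the color of \<open>v\<close>, which gives a
  coloring of \<open>G1\<close> or of \<open>G2\<close>. In the other direction a third color is available to separate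
  \<open>u1\<close>, \<open>u2\<close> and \<open>v\<close>. If \<open>G1\<close> and \<open>G2\<close> are critical, deleting an old edge from one side gives a
  coloring with \<open>u1\<close> and \<open>v\<close> different there and \<open>u2\<close> and \<open>v\<close> equal on the other side; after
  deleting a new edge, the remaining one acts like a single edge from \<open>u1\<close> to \<open>v\<close>.\<close>

section \<open>Forests and even edge sets\<close>

definition degree_in :: "('e \<Rightarrow> 'v set) \<Rightarrow> 'e set \<Rightarrow> 'v \<Rightarrow> nat" where
  "degree_in d S x = card {e \<in> S. x \<in> d e}"

text \<open>For finite \<open>S\<close> these are the elements of the cycle space over the field
  with two elements.\<close>

definition even_edge_set :: "('e \<Rightarrow> 'v set) \<Rightarrow> 'e set \<Rightarrow> bool" where
  "even_edge_set d S \<longleftrightarrow> (\<forall>x. even (degree_in d S x))"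

lemma degree_in_cong:
  "S = T \<Longrightarrow> (\<And>e. e \<in> T \<Longrightarrow> d e = d' e) \<Longrightarrow> degree_in d S x = degree_in d' T x"
  unfolding degree_in_def by (metis (mono_tags, lifting) Collect_cong)

lemma degree_in_eq_0: "(\<And>e. e \<in> S \<Longrightarrow> x \<notin> d e) \<Longrightarrow> degree_in d S x = 0"
  unfolding degree_in_def by (metis (mono_tags, lifting) card.empty empty_Collect_eq)

lemma degree_in_insert:
  assumes "finite S" "e \<notin> S"
  shows "degree_in d (insert e S) x = degree_in d S x + (if x \<in> d e then 1 else 0)"
proof -
  have "{f \<in> insert e S. x \<in> d f} = (if x \<in> d e then insert e {f \<in> S. x \<in> d f} else {f \<in> S. x \<in> d f})"
    by auto
  then show ?thesis using assms by (simp add: degree_in_def)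
qed

text \<open>The handshake lemma: each new edge raises exactly two of the degrees by one.\<close>

lemma sum_degree_in:
  assumes "finite S" "finite V" "\<And>e. e \<in> S \<Longrightarrow> d e \<subseteq> V \<and> card (d e) = 2"
  shows "(\<Sum>x\<in>V. degree_in d S x) = 2 * card S"
  using assms(1,3)
proof (induction S rule: finite_induct)
  case empty
  then show ?case by (simp add: degree_in_def)
next
  case (insert e S)
  have "V \<inter> d e = d e" "card (d e) = 2" using insert.prems by blast+
  then have "(\<Sum>x\<in>V. if x \<in> d e then 1 else 0) = (2::nat)"
    using assms(2) by (simp flip: sum.inter_restrict)
  then show ?case using insert by (simp add: degree_in_insert sum.distrib)
qed

text \<open>The sum of all degrees is even, so once all the others are even, the two remaining
  degrees have the same parity.\<close>

lemma even_degree_in_transfer: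
  assumes "finite S" "finite V" "\<And>e. e \<in> S \<Longrightarrow> d e \<subseteq> V \<and> card (d e) = 2"
    and "u \<in> V" "v \<in> V" "u \<noteq> v"
    and "\<And>x. x \<in> V \<Longrightarrow> x \<noteq> u \<Longrightarrow> x \<noteq> v \<Longrightarrow> even (degree_in d S x)"
  shows "even (degree_in d S u) \<longleftrightarrow> even (degree_in d S v)"
proof -
  have "(\<Sum>x\<in>V. degree_in d S x)
      = degree_in d S u + (degree_in d S v + (\<Sum>x\<in>V - {u} - {v}. degree_in d S x))"
    using assms(2,4-6) by (simp add: sum.remove[of V u] sum.remove[of "V - {u}" v])
  moreover have "even (\<Sum>x\<in>V - {u} - {v}. degree_in d S x)"
    using assms(7) by (intro dvd_sum) auto
  moreover have "even (\<Sum>x\<in>V. degree_in d S x)"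
    using sum_degree_in[of S V d, OF assms(1-3)] by simp
  ultimately show ?thesis by auto
qed

text \<open>A vertex of the cycle lies on exactly two of its edges, the one leaving it and the one
  entering it; any other vertex lies on none.\<close>

lemma is_cycle_even_edge_set:
  assumes "is_cycle G vs es"
  shows "even_edge_set (ends G) (set es)"
  unfolding even_edge_set_def
proof
  fix x
  let ?n = "length vs"
  have n: "?n \<ge> 2" "length es = ?n" and dist: "distinct vs" "distinct es"
    and e: "\<And>i. i < ?n \<Longrightarrow> ends G (es ! i) = {vs ! i, vs ! (Suc i mod ?n)}"
    using assms unfolding is_cycle_def by auto
  show "even (degree_in (ends G) (set es) x)"
  proof (cases "x \<in> set vs")
    case False
    have "x \<notin> ends G f" if f: "f \<in> set es" for f
    proof -
      obtain i where i: "i < ?n" "f = es ! i" using f n by (metis in_set_conv_nth)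
      have "Suc i mod ?n < ?n" using n(1) by (intro mod_less_divisor) linarith
      then have "vs ! i \<in> set vs" "vs ! (Suc i mod ?n) \<in> set vs" using i(1) by simp_all
      then show ?thesis using e[OF i(1)] i(2) False by (metis insertE singletonD)
    qed
    then show ?thesis by (simp add: degree_in_eq_0)
  next
    case True
    then obtain j where j: "j < ?n" "x = vs ! j" by (metis in_set_conv_nth)
    \<comment> \<open>The cyclic predecessor of \<open>j\<close>: the edge \<open>es ! ?p\<close> is
      the one that enters \<open>vs ! j\<close>.\<close>
    let ?p = "if j = 0 then ?n - 1 else j - 1"
    have p: "?p < ?n" "?p \<noteq> j" "Suc ?p mod ?n = j" using j n by auto
    have mod: "Suc i mod ?n = (if Suc i = ?n then 0 else Suc i)" if "i < ?n" for i
      using that by auto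
    have inc: "x \<in> ends G (es ! i) \<longleftrightarrow> i = j \<or> i = ?p" if i: "i < ?n" for i
    proof -
      have "Suc i mod ?n < ?n" using n(1) by (intro mod_less_divisor) linarith
      then have "x \<in> ends G (es ! i) \<longleftrightarrow> i = j \<or> Suc i mod ?n = j"
        using e[OF i] j i dist(1) by (auto simp: nth_eq_iff_index_eq)
      also have "\<dots> \<longleftrightarrow> i = j \<or> i = ?p" using mod[OF i] i j n by auto
      finally show ?thesis .
    qed
    have "{f \<in> set es. x \<in> ends G f} = {es ! j, es ! ?p}"
    proof (intro set_eqI iffI)
      fix f assume "f \<in> {f \<in> set es. x \<in> ends G f}"
      then obtain i where "i < ?n" "f = es ! i" "x \<in> ends G (es ! i)"
        using n by (metis (mono_tags, lifting) in_set_conv_nth mem_Collect_eq)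
      then show "f \<in> {es ! j, es ! ?p}" using inc by auto
    next
      fix f assume "f \<in> {es ! j, es ! ?p}"
      then obtain i where i: "f = es ! i" "i = j \<or> i = ?p" by blast
      then have "i < ?n" using p(1) j(1) by auto
      then show "f \<in> {f \<in> set es. x \<in> ends G f}" using i inc n by auto
    qed
    \<comment> \<open>On a cycle of length two both edges have the same ends, so only
      \<open>distinct es\<close> tells them apart.\<close>
    moreover have "es ! j \<noteq> es ! ?p"
      using nth_eq_iff_index_eq[OF dist(2), of j ?p] p(1,2) j(1) n(2) by (simp split del: if_split)
    ultimately show ?thesis by (simp add: degree_in_def)
  qed
qed

text \<open>Distinctness of the edges is left out because it follows from that of the
  vertices.\<close>

definition edge_path :: "('e \<Rightarrow> 'v set) \<Rightarrow> 'e set \<Rightarrow> 'v list \<Rightarrow> 'e list \<Rightarrow> bool" where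
  "edge_path d S vs es \<longleftrightarrow> distinct vs \<and> length vs = Suc (length es) \<and> set es \<subseteq> S \<and>
     (\<forall>i < length es. d (es ! i) = {vs ! i, vs ! Suc i})"

text \<open>All degrees are at least 2, so the first vertex of a longest path has a further edge,
  which leads back to the path.\<close>

lemma even_edge_set_imp_cycle:
  assumes G: "multigraph G" and S: "S \<subseteq> edges G" "S \<noteq> {}" "even_edge_set (ends G) S"
  shows "\<exists>vs es. is_cycle G vs es"
proof -
  let ?d = "ends G"
  have fin: "finite (verts G)" "finite S"
    and d: "\<And>e. e \<in> S \<Longrightarrow> ?d e \<subseteq> verts G \<and> card (?d e) = 2"
    using G S unfolding multigraph_def by (auto intro: finite_subset)
  \<comment> \<open>With at least one edge on the path, every vertex of it is an end of an edge in
    \<open>S\<close> and hence lies in \<open>verts G\<close>. This bounds the length, so a longest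
    path exists.\<close>
  define P where "P = (\<lambda>(vs, es). edge_path ?d S vs es \<and> es \<noteq> [])"
  have sub: "set vs \<subseteq> verts G" if "P (vs, es)" for vs es
  proof
    fix x assume "x \<in> set vs"
    then obtain i where i: "i < length vs" "x = vs ! i" by (metis in_set_conv_nth)
    have p: "length vs = Suc (length es)" "set es \<subseteq> S" "es \<noteq> []"
      "\<forall>i < length es. ?d (es ! i) = {vs ! i, vs ! Suc i}"
      using that unfolding P_def edge_path_def by auto
    obtain j where "j < length es" "x \<in> ?d (es ! j)"
    proof (cases "i < length es")
      case True
      then show thesis using that p(4) i by blast
    next
      case False
      then have "i = Suc (length es - 1)" using i p by (cases es) auto
      then show thesis using that[of "length es - 1"] p(3,4) i by auto
    qed
    then show "x \<in> verts G" using d p(2) by (meson nth_mem subsetD)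
  qed
  obtain e0 where e0: "e0 \<in> S" using S by blast
  then obtain a b where ab: "?d e0 = {a, b}" "a \<noteq> b" using d by (meson card_2_iff)
  have "P ([a, b], [e0])"
    using e0 ab unfolding P_def edge_path_def by auto
  moreover have "\<forall>y. P y \<longrightarrow> length (fst y) < Suc (card (verts G))"
  proof (intro allI impI)
    fix y assume "P y"
    then obtain vs es where y: "y = (vs, es)" "P (vs, es)" by (cases y) auto
    then have "distinct vs" unfolding P_def edge_path_def by auto
    then show "length (fst y) < Suc (card (verts G))"
      using card_mono[OF fin(1) sub[OF y(2)]] y(1) by (simp add: distinct_card)
  qed
  ultimately obtain y where y: "P y" "\<forall>z. P z \<longrightarrow> length (fst z) \<le> length (fst y)"
    by (rule ex_has_greatest_nat[THEN exE]) blast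
  obtain vs es where ve: "y = (vs, es)" by (cases y)
  have p: "distinct vs" "length vs = Suc (length es)" "set es \<subseteq> S" "es \<noteq> []"
      "\<And>i. i < length es \<Longrightarrow> ?d (es ! i) = {vs ! i, vs ! Suc i}"
    using y(1) unfolding ve P_def edge_path_def by auto
  let ?w = "vs ! 0"
  have es0: "es ! 0 \<in> S" "?w \<in> ?d (es ! 0)" using p by (auto intro!: nth_mem)
  \<comment> \<open>If \<open>es ! 0\<close> were the only edge at the first vertex, the degree
    there would be 1, which is odd.\<close>
  have "\<exists>e \<in> S. ?w \<in> ?d e \<and> e \<noteq> es ! 0"
  proof (rule ccontr)
    assume "\<not> ?thesis"
    then have "{e \<in> S. ?w \<in> ?d e} = {es ! 0}" using es0 by blast
    then have "degree_in ?d S ?w = 1" by (simp add: degree_in_def)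
    moreover have "even (degree_in ?d S ?w)" using S(3) unfolding even_edge_set_def by blast
    ultimately show False by simp
  qed
  then obtain e where e: "e \<in> S" "?w \<in> ?d e" "e \<noteq> es ! 0" by blast
  then obtain x where x: "?d e = {x, ?w}" "x \<noteq> ?w"
    using d[of e] by (metis card_2_iff doubleton_eq_iff insertE singletonD)
  \<comment> \<open>Otherwise \<open>x\<close> could be put in front of the path, against its
    maximal length.\<close>
  have "x \<in> set vs"
  proof (rule ccontr)
    assume "x \<notin> set vs"
    moreover have "?d ((e # es) ! i) = {(x # vs) ! i, (x # vs) ! Suc i}" if "i < length (e # es)" for i
      using that p(5) x(1) by (cases i) auto
    ultimately have "P (x # vs, e # es)"
      using p e(1) unfolding P_def edge_path_def by auto
    then show False using y(2) ve by fastforce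
  qed
  then obtain j where j: "j < length vs" "x = vs ! j" by (metis in_set_conv_nth)
  have j0: "j > 0" using x(2) j(2) by (cases j) auto
  have jl: "j \<le> length es" using j p(2) by simp
  \<comment> \<open>The edge \<open>e\<close> closes the first \<open>j\<close> edges to a cycle. It
    is new, since \<open>es ! 0\<close> is the only edge of the path that contains the first
    vertex.\<close>
  have "e \<notin> set (take j es)"
  proof
    assume "e \<in> set (take j es)"
    then obtain i where i: "i < j" "i < length es" "e = es ! i"
      by (auto simp: in_set_conv_nth)
    then have "?w \<in> {vs ! i, vs ! Suc i}" using e(2) p(5) by simp
    then have "i = 0" using p(1,2) i nth_eq_iff_index_eq[OF p(1), of 0 i]
        nth_eq_iff_index_eq[OF p(1), of 0 "Suc i"] by auto
    then show False using i e(3) by simp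
  qed
  moreover have "distinct es"
    unfolding distinct_conv_nth
  proof (intro allI impI)
    fix i l assume il: "i < length es" "l < length es" "i \<noteq> l"
    show "es ! i \<noteq> es ! l"
    proof
      assume "es ! i = es ! l"
      then have "{vs ! i, vs ! Suc i} = {vs ! l, vs ! Suc l}" using p(5) il by metis
      then show False using il p(1,2) by (auto simp: doubleton_eq_iff nth_eq_iff_index_eq)
    qed
  qed
  moreover have "?d ((take j es @ [e]) ! i) = {take (Suc j) vs ! i, take (Suc j) vs ! (Suc i mod Suc j)}"
    if "i < Suc j" for i
  proof (cases "i < j")
    case True
    then have "Suc i mod Suc j = Suc i" by simp
    then show ?thesis using True p(5) jl by (simp add: nth_append)
  next
    case False
    then have "i = j" using that by simp
    then show ?thesis using x(1) j jl by (simp add: nth_append)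
  qed
  moreover have "set (take j es) \<subseteq> S" using p(3) set_take_subset[of j es] by blast
  moreover have "set (take (Suc j) vs) \<subseteq> verts G"
    using sub y(1) ve set_take_subset[of "Suc j" vs] by blast
  ultimately have "is_cycle G (take (Suc j) vs) (take j es @ [e])"
    using p(1,2) j jl j0 e(1) S(1) unfolding is_cycle_def by auto
  then show ?thesis by blast
qed

lemma forest_iff_even_edge_set:
  assumes "multigraph G"
  shows "forest G \<longleftrightarrow> (\<forall>S \<subseteq> edges G. even_edge_set (ends G) S \<longrightarrow> S = {})"
proof
  assume "forest G"
  then show "\<forall>S \<subseteq> edges G. even_edge_set (ends G) S \<longrightarrow> S = {}"
    using even_edge_set_imp_cycle[OF assms] unfolding forest_def by blast
next
  assume *: "\<forall>S \<subseteq> edges G. even_edge_set (ends G) S \<longrightarrow> S = {}"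
  show "forest G"
    unfolding forest_def
  proof
    assume "\<exists>vs es. is_cycle G vs es"
    then obtain vs es where c: "is_cycle G vs es" by blast
    then have "set es \<subseteq> edges G" "es \<noteq> []" unfolding is_cycle_def by auto
    then show False using * is_cycle_even_edge_set[OF c] by (metis set_empty)
  qed
qed

section \<open>Acyclic colorings\<close>

definition monochromatic :: "('v \<Rightarrow> nat) \<Rightarrow> 'v set \<Rightarrow> bool" where
  "monochromatic c X \<longleftrightarrow> (\<exists>i. \<forall>x \<in> X. c x = i)"

text \<open>Stated for an edge set and an incidence function, so that deleting edges and gluing
  graphs only change the set \<open>E\<close>.\<close>

definition acyclic_coloring :: "'e set \<Rightarrow> ('e \<Rightarrow> 'v set) \<Rightarrow> ('v \<Rightarrow> nat) \<Rightarrow> bool" where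
  "acyclic_coloring E d c \<longleftrightarrow>
     (\<forall>S \<subseteq> E. (\<forall>e \<in> S. monochromatic c (d e)) \<and> even_edge_set d S \<longrightarrow> S = {})"

text \<open>Colors are bounded on the whole vertex type, which avoids carrying a vertex set along;
  the comparison with \<open>forest_coloring\<close> then asks for \<open>k \<ge> 1\<close>.\<close>

definition colorable :: "'e set \<Rightarrow> ('e \<Rightarrow> 'v set) \<Rightarrow> nat \<Rightarrow> bool" where
  "colorable E d k \<longleftrightarrow> (\<exists>c. (\<forall>x. c x < k) \<and> acyclic_coloring E d c)"

lemma monochromatic_doubleton [simp]: "monochromatic c {x, y} \<longleftrightarrow> c x = c y"
  unfolding monochromatic_def by auto

lemma monochromatic_cong: "(\<And>x. x \<in> X \<Longrightarrow> c x = c' x) \<Longrightarrow> monochromatic c X = monochromatic c' X"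
  unfolding monochromatic_def by simp

lemma acyclic_coloring_mono:
  "acyclic_coloring E d c \<Longrightarrow> E' \<subseteq> E \<Longrightarrow> acyclic_coloring E' d c"
  unfolding acyclic_coloring_def by blast

lemma acyclic_coloring_cong:
  assumes "\<And>e. e \<in> E \<Longrightarrow> d e = d' e"
    and "\<And>e x. e \<in> E \<Longrightarrow> x \<in> d' e \<Longrightarrow> c x = c' x"
  shows "acyclic_coloring E d c \<longleftrightarrow> acyclic_coloring E d' c'"
proof -
  have "monochromatic c (d e) \<longleftrightarrow> monochromatic c' (d' e)" if "e \<in> E" for e
    using monochromatic_cong[of "d' e" c c'] assms that by simp
  then have "(\<forall>e \<in> S. monochromatic c (d e)) \<longleftrightarrow> (\<forall>e \<in> S. monochromatic c' (d' e))" if "S \<subseteq> E" for S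
    using that by blast
  moreover have "even_edge_set d S \<longleftrightarrow> even_edge_set d' S" if "S \<subseteq> E" for S
  proof -
    have "degree_in d S x = degree_in d' S x" for x
      using that assms(1) by (intro degree_in_cong) auto
    then show ?thesis unfolding even_edge_set_def by simp
  qed
  ultimately show ?thesis unfolding acyclic_coloring_def by simp
qed

text \<open>Only equality of colors matters. This is applied to transpositions of colors.\<close>

lemma acyclic_coloring_inj:
  assumes "inj p"
  shows "acyclic_coloring E d (p \<circ> c) \<longleftrightarrow> acyclic_coloring E d c"
proof -
  have "monochromatic (p \<circ> c) X \<longleftrightarrow> monochromatic c X" for X
    unfolding monochromatic_def using assms by (metis comp_apply injD)
  then show ?thesis unfolding acyclic_coloring_def by simp
qed

text \<open>Identifying two vertices from different graphs is injective on each of the two graphs,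
  so it merely renames a vertex there.\<close>

lemma acyclic_coloring_rename:
  assumes "inj_on f V" "\<And>e. e \<in> E \<Longrightarrow> d e \<subseteq> V"
  shows "acyclic_coloring E (\<lambda>e. f ` d e) c \<longleftrightarrow> acyclic_coloring E d (c \<circ> f)"
proof -
  have m: "monochromatic c (f ` X) \<longleftrightarrow> monochromatic (c \<circ> f) X" for X
    unfolding monochromatic_def by auto
  have "even_edge_set (\<lambda>e. f ` d e) S \<longleftrightarrow> even_edge_set d S" if S: "S \<subseteq> E" for S
  proof -
    have 1: "degree_in (\<lambda>e. f ` d e) S (f x) = degree_in d S x" if "x \<in> V" for x
    proof -
      have "f x \<in> f ` d e \<longleftrightarrow> x \<in> d e" if "e \<in> S" for e
        using S assms \<open>x \<in> V\<close> that by (meson inj_on_image_mem_iff subsetD)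
      then have "{e \<in> S. f x \<in> f ` d e} = {e \<in> S. x \<in> d e}" by blast
      then show ?thesis by (simp add: degree_in_def)
    qed
    have 2: "degree_in (\<lambda>e. f ` d e) S y = 0" if "y \<notin> f ` V" for y
      using that S assms(2) by (intro degree_in_eq_0) blast
    have 3: "degree_in d S x = 0" if "x \<notin> V" for x
      using that S assms(2) by (intro degree_in_eq_0) blast
    show ?thesis unfolding even_edge_set_def
    proof (intro iffI allI)
      fix x assume "\<forall>y. even (degree_in (\<lambda>e. f ` d e) S y)"
      then show "even (degree_in d S x)" using 1[of x] 3[of x] by (cases "x \<in> V") (metis, simp)
    next
      fix y assume "\<forall>x. even (degree_in d S x)"
      then show "even (degree_in (\<lambda>e. f ` d e) S y)" using 1 2[of y] by (cases "y \<in> f ` V") auto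
    qed
  qed
  then show ?thesis unfolding acyclic_coloring_def m by simp
qed

text \<open>A bichromatic edge lies in no monochromatic edge set. In this way deleted parallel edges
  are put back and new edges are added.\<close>

lemma acyclic_coloring_add_bichromatic:
  assumes "acyclic_coloring E d c" "\<And>e. e \<in> F \<Longrightarrow> \<not> monochromatic c (d e)"
  shows "acyclic_coloring (E \<union> F) d c"
  unfolding acyclic_coloring_def
proof (intro allI impI)
  fix S assume S: "S \<subseteq> E \<union> F" "(\<forall>e \<in> S. monochromatic c (d e)) \<and> even_edge_set d S"
  then have "S \<subseteq> E" using assms(2) by blast
  then show "S = {}" using S(2) assms(1) unfolding acyclic_coloring_def by blast
qed

text \<open>Two parallel edges form an even set, as every degree in it is 0 or 2.\<close>

lemma acyclic_coloring_parallel: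
  assumes "acyclic_coloring E d c" "D \<subseteq> E" "card D = 2" "\<And>e. e \<in> D \<Longrightarrow> d e = {x, y}"
  shows "c x \<noteq> c y"
proof
  assume "c x = c y"
  then have "\<forall>e \<in> D. monochromatic c (d e)" using assms(4) by simp
  moreover have "even_edge_set d D" unfolding even_edge_set_def
  proof
    fix z
    have "{e \<in> D. z \<in> d e} = (if z \<in> {x, y} then D else {})" using assms(4) by auto
    then show "even (degree_in d D z)" using assms(3) by (simp add: degree_in_def)
  qed
  moreover have "D \<noteq> {}" using assms(3) by auto
  ultimately show False using assms(1,2) unfolding acyclic_coloring_def by blast
qed

lemma colorable_mono: "colorable E d k \<Longrightarrow> E' \<subseteq> E \<Longrightarrow> colorable E' d k"
  unfolding colorable_def using acyclic_coloring_mono by blast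

lemma colorable_cong: "(\<And>e. e \<in> E \<Longrightarrow> d e = d' e) \<Longrightarrow> colorable E d k \<longleftrightarrow> colorable E d' k"
  unfolding colorable_def using acyclic_coloring_cong[of E d d'] by blast

lemma colorable_rename:
  assumes "inj_on f V" "\<And>e. e \<in> E \<Longrightarrow> d e \<subseteq> V"
  shows "colorable E (\<lambda>e. f ` d e) k \<longleftrightarrow> colorable E d k"
proof
  assume "colorable E (\<lambda>e. f ` d e) k"
  then obtain c where "\<forall>x. c x < k" "acyclic_coloring E (\<lambda>e. f ` d e) c"
    unfolding colorable_def by blast
  then have "\<forall>x. (c \<circ> f) x < k" "acyclic_coloring E d (c \<circ> f)"
    using acyclic_coloring_rename[of f V E d c, OF assms] by auto
  then show "colorable E d k" unfolding colorable_def by blast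
next
  assume "colorable E d k"
  then obtain c where c: "\<forall>x. c x < k" "acyclic_coloring E d c"
    unfolding colorable_def by blast
  \<comment> \<open>Outside the image of \<open>V\<close> the inverse is arbitrary, which is
    harmless because \<open>c\<close> is bounded everywhere.\<close>
  let ?c = "c \<circ> inv_into V f"
  have "acyclic_coloring E d (?c \<circ> f)"
  proof (subst acyclic_coloring_cong[of E d d _ c])
    show "(?c \<circ> f) x = c x" if "e \<in> E" "x \<in> d e" for e x
      using assms(2)[OF that(1)] that(2) inv_into_f_f[OF assms(1), of x] by auto
  qed (simp_all add: c(2))
  then have "acyclic_coloring E (\<lambda>e. f ` d e) ?c"
    using acyclic_coloring_rename[of f V E d ?c, OF assms] by blast
  then show "colorable E (\<lambda>e. f ` d e) k" unfolding colorable_def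
    using c(1) by (intro exI[of _ ?c]) simp
qed

section \<open>Translation of forest colorings and \<open>chi2\<close> into colorings of edge
  sets\<close>

lemma forest_coloring_iff:
  assumes G: "multigraph G"
  shows "forest_coloring G k c \<longleftrightarrow>
    (\<forall>v \<in> verts G. c v < k) \<and> acyclic_coloring (edges G) (ends G) c"
proof (cases "\<forall>v \<in> verts G. c v < k")
  case True
  let ?H = "\<lambda>i. induced_subgraph G {v \<in> verts G. c v = i}"
  have sub: "ends G e \<subseteq> verts G" "card (ends G e) = 2" if "e \<in> edges G" for e
    using G that unfolding multigraph_def by auto
  have H: "multigraph (?H i)" for i
    using G unfolding multigraph_def induced_subgraph_def by auto
  have edgesH: "edges (?H i) = {e \<in> edges G. \<forall>x \<in> ends G e. c x = i}"
    and endsH: "ends (?H i) = ends G" for i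
    using sub unfolding induced_subgraph_def by auto
  have "(\<forall>i < k. forest (?H i)) \<longleftrightarrow> acyclic_coloring (edges G) (ends G) c"
  proof
    assume F: "\<forall>i < k. forest (?H i)"
    show "acyclic_coloring (edges G) (ends G) c"
      unfolding acyclic_coloring_def
    proof (intro allI impI, rule ccontr)
      fix S
      assume S: "S \<subseteq> edges G" "(\<forall>e\<in>S. monochromatic c (ends G e)) \<and> even_edge_set (ends G) S"
        and "S \<noteq> {}"
      then obtain e where e: "e \<in> S" by blast
      then obtain i where i: "\<forall>x \<in> ends G e. c x = i" using S(2) unfolding monochromatic_def by blast
      have "card (ends G e) = 2" using sub(2) e S(1) by blast
      then obtain x where x: "x \<in> ends G e" by (metis card.empty equals0I zero_neq_numeral)
      then have "x \<in> verts G" "c x = i" using sub(1) e S(1) i by auto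
      then have ik: "i < k" using True by blast
      \<comment> \<open>The part of \<open>S\<close> in color class \<open>i\<close>. It is even: at
        a vertex of color \<open>i\<close> all edges of \<open>S\<close> belong to it, at any other
        vertex none does.\<close>
      let ?T = "{e \<in> S. \<forall>x \<in> ends G e. c x = i}"
      have "even (degree_in (ends G) ?T x)" for x
      proof (cases "c x = i")
        case True
        have "\<forall>y \<in> ends G e. c y = i" if "e \<in> S" "x \<in> ends G e" for e
          using True S(2) that unfolding monochromatic_def by metis
        then have "{e \<in> ?T. x \<in> ends G e} = {e \<in> S. x \<in> ends G e}" by blast
        then have "degree_in (ends G) ?T x = degree_in (ends G) S x" by (simp add: degree_in_def)
        then show ?thesis using S(2) unfolding even_edge_set_def by simp
      next
        case False
        then have "degree_in (ends G) ?T x = 0" by (intro degree_in_eq_0) auto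
        then show ?thesis by simp
      qed
      then have "even_edge_set (ends G) ?T" unfolding even_edge_set_def by blast
      moreover have "?T \<subseteq> edges (?H i)" using S(1) edgesH by auto
      moreover have "?T \<noteq> {}" using e i by auto
      moreover have "\<forall>T \<subseteq> edges (?H i). even_edge_set (ends G) T \<longrightarrow> T = {}"
        using F ik forest_iff_even_edge_set[OF H[of i]] endsH[of i] by simp
      ultimately show False by blast
    qed
  next
    assume A: "acyclic_coloring (edges G) (ends G) c"
    show "\<forall>i < k. forest (?H i)"
    proof (intro allI impI)
      fix i
      show "forest (?H i)"
        unfolding forest_iff_even_edge_set[OF H] endsH edgesH
        using A unfolding acyclic_coloring_def monochromatic_def by blast
    qed
  qed
  then show ?thesis using True unfolding forest_coloring_def by simp
next
  case False
  then show ?thesis unfolding forest_coloring_def by blast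
qed

lemma ex_forest_coloring_iff_colorable:
  assumes G: "multigraph G" and k: "k \<ge> 1"
  shows "(\<exists>c. forest_coloring G k c) \<longleftrightarrow> colorable (edges G) (ends G) k"
proof
  assume "\<exists>c. forest_coloring G k c"
  then obtain c where c: "\<forall>v \<in> verts G. c v < k" "acyclic_coloring (edges G) (ends G) c"
    using forest_coloring_iff[OF G] by blast
  let ?c = "\<lambda>x. if x \<in> verts G then c x else 0"
  have "acyclic_coloring (edges G) (ends G) ?c"
    using c(2) G unfolding multigraph_def
    by (subst acyclic_coloring_cong[of _ _ "ends G" _ c]) auto
  then show "colorable (edges G) (ends G) k" unfolding colorable_def using c(1) k
    by (intro exI[of _ ?c]) auto
qed (auto simp: colorable_def forest_coloring_iff[OF G])

lemma chi2_le_iff: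
  assumes G: "multigraph G" and k: "k \<ge> 1"
  shows "chi2 G \<le> k \<longleftrightarrow> colorable (edges G) (ends G) k"
proof
  \<comment> \<open>Giving all vertices different colors shows that \<open>LEAST\<close> in
    \<open>chi2\<close> is taken over a non-empty set.\<close>
  obtain h where "bij_betw h (verts G) {0..<card (verts G)}"
    using G ex_bij_betw_finite_nat unfolding multigraph_def by blast
  then have h: "inj_on h (verts G)" "\<forall>v \<in> verts G. h v < card (verts G)"
    unfolding bij_betw_def by auto
  have "\<not> monochromatic h (ends G e)" if e: "e \<in> edges G" for e
  proof -
    obtain x y where "ends G e = {x, y}" "x \<noteq> y" "ends G e \<subseteq> verts G"
      using G e unfolding multigraph_def by (meson card_2_iff)
    then show ?thesis using h(1) by (auto dest: inj_onD)
  qed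
  then have "acyclic_coloring (edges G) (ends G) h"
    unfolding acyclic_coloring_def by blast
  then have ex: "\<exists>k c. forest_coloring G k c" using h(2) forest_coloring_iff[OF G] by blast
  assume le: "chi2 G \<le> k"
  have "\<exists>c. forest_coloring G (chi2 G) c"
    unfolding chi2_def using ex by (rule LeastI_ex)
  then have "\<exists>c. forest_coloring G k c"
    using le forest_coloring_iff[OF G] by (meson less_le_trans)
  then show "colorable (edges G) (ends G) k"
    using ex_forest_coloring_iff_colorable[OF G k] by blast
next
  assume "colorable (edges G) (ends G) k"
  then show "chi2 G \<le> k" unfolding chi2_def
    using ex_forest_coloring_iff_colorable[OF G k] by (intro Least_le) blast
qed

text \<open>The bound \<open>k \<ge> 2\<close> allows \<open>chi2_le_iff\<close> to be used for
  \<open>k - 1\<close> as well.\<close>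

lemma chi2_eq_iff:
  assumes "multigraph G" "k \<ge> 2"
  shows "chi2 G = k \<longleftrightarrow>
    colorable (edges G) (ends G) k \<and> \<not> colorable (edges G) (ends G) (k - 1)"
proof -
  have k: "1 \<le> k" "1 \<le> k - 1" using assms(2) by auto
  have "chi2 G = k \<longleftrightarrow> chi2 G \<le> k \<and> \<not> chi2 G \<le> k - 1" using k by linarith
  then show ?thesis using chi2_le_iff[OF assms(1) k(1)] chi2_le_iff[OF assms(1) k(2)] by simp
qed

section \<open>Critical graphs\<close>

lemma Cri2_colorable_delete_edge:
  assumes "G \<in> Cri2 k" "k \<ge> 2" "e \<in> edges G"
  shows "colorable (edges G - {e}) (ends G) (k - 1)"
proof -
  have G: "multigraph G" and c: "\<And>H. proper_subgraph H G \<Longrightarrow> chi2 H < k"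
    using assms(1) unfolding Cri2_def chi2_critical_def by auto
  let ?H = "delete_edges G {e}"
  have H: "multigraph ?H" using G unfolding multigraph_def delete_edges_def by auto
  then have "proper_subgraph ?H G"
    using assms(3) unfolding proper_subgraph_def subgraph_def delete_edges_def by auto
  then have "chi2 ?H \<le> k - 1" using c by fastforce
  then show ?thesis using chi2_le_iff[OF H, of "k - 1"] assms(2) by (simp add: delete_edges_def)
qed

text \<open>Removing an isolated vertex gives a proper subgraph with the same edges, hence with the
  same colorability.\<close>

lemma Cri2_vertex_incident:
  assumes "G \<in> Cri2 k" "k \<ge> 2" "x \<in> verts G"
  shows "\<exists>e \<in> edges G. x \<in> ends G e"
proof (rule ccontr)
  assume no: "\<not> ?thesis"
  have G: "multigraph G" "chi2 G = k" and c: "\<And>H. proper_subgraph H G \<Longrightarrow> chi2 H < k"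
    using assms(1) unfolding Cri2_def chi2_critical_def by auto
  let ?H = "G\<lparr>verts := verts G - {x}\<rparr>"
  have H: "multigraph ?H" using G no unfolding multigraph_def by auto
  then have "proper_subgraph ?H G"
    using assms(3) unfolding proper_subgraph_def subgraph_def by auto
  then have "chi2 ?H \<le> k - 1" using c by fastforce
  then have "colorable (edges G) (ends G) (k - 1)"
    using chi2_le_iff[OF H, of "k - 1"] assms(2) by simp
  then show False using chi2_eq_iff[OF G(1) assms(2)] G(2) by blast
qed

text \<open>Reduces criticality to single edges: a subgraph that lacks a vertex also lacks an edge
  at that vertex, so every proper subgraph avoids some edge.\<close>

lemma Cri2I:
  assumes G: "multigraph G" "chi2 G = k" "k \<ge> 2"
    and e: "\<And>e. e \<in> edges G \<Longrightarrow> colorable (edges G - {e}) (ends G) (k - 1)"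
    and v: "\<And>x. x \<in> verts G \<Longrightarrow> \<exists>e \<in> edges G. x \<in> ends G e"
  shows "G \<in> Cri2 k"
proof -
  have "chi2 H < k" if H: "proper_subgraph H G" for H
  proof -
    have s: "multigraph H" "verts H \<subseteq> verts G" "edges H \<subseteq> edges G"
      "\<And>e. e \<in> edges H \<Longrightarrow> ends H e = ends G e"
      "verts H \<noteq> verts G \<or> edges H \<noteq> edges G"
      using H unfolding proper_subgraph_def subgraph_def by auto
    have "edges H \<noteq> edges G"
    proof
      assume eq: "edges H = edges G"
      then obtain x where x: "x \<in> verts G" "x \<notin> verts H" using s by blast
      then obtain f where "f \<in> edges G" "x \<in> ends G f" using v by blast
      then have "ends H f \<subseteq> verts H" "x \<in> ends H f" using s(1,4) eq unfolding multigraph_def by auto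
      then show False using x by blast
    qed
    then obtain f where "f \<in> edges G" "edges H \<subseteq> edges G - {f}" using s(3) by blast
    then have "colorable (edges H) (ends G) (k - 1)" using e colorable_mono by blast
    then have "colorable (edges H) (ends H) (k - 1)" using colorable_cong s(4) by metis
    then have "chi2 H \<le> k - 1" using chi2_le_iff[OF s(1)] G(3) by simp
    then show ?thesis using G(3) by simp
  qed
  then show ?thesis using G unfolding Cri2_def chi2_critical_def by simp
qed

section \<open>Joining two edge sets at a vertex\<close>

text \<open>One incidence function serves both sides, so that edge sets from either side, and their
  unions, live in one graph with cut vertex \<open>v\<close>.\<close>

locale vertex_join =
  fixes d :: "'e \<Rightarrow> 'v set" and A B :: "'e set" and VA VB :: "'v set" and v :: 'v
  assumes finA: "finite A" "finite VA" and finB: "finite B" "finite VB"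
    and AB: "A \<inter> B = {}" and V: "VA \<inter> VB = {v}"
    and dA: "\<And>e. e \<in> A \<Longrightarrow> d e \<subseteq> VA \<and> card (d e) = 2"
    and dB: "\<And>e. e \<in> B \<Longrightarrow> d e \<subseteq> VB \<and> card (d e) = 2"
begin

lemma degree_in_left:
  assumes "S \<subseteq> A \<union> B" "x \<in> VA" "x \<noteq> v"
  shows "degree_in d (S \<inter> A) x = degree_in d S x"
proof -
  have "{e \<in> S \<inter> A. x \<in> d e} = {e \<in> S. x \<in> d e}" using assms V dB by blast
  then show ?thesis by (simp add: degree_in_def)
qed

text \<open>Away from \<open>v\<close> a degree is either unchanged or zero. The parity at
  \<open>v\<close> follows by comparison with any other vertex of \<open>VA\<close>.\<close>

lemma even_edge_set_left:
  assumes S: "S \<subseteq> A \<union> B" and ev: "even_edge_set d S"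
  shows "even_edge_set d (S \<inter> A)"
proof -
  have fin: "finite (S \<inter> A)" using finA by simp
  have ev': "even (degree_in d (S \<inter> A) x)" if "x \<noteq> v" for x
  proof (cases "x \<in> VA")
    case True
    then show ?thesis using degree_in_left[OF S] that ev unfolding even_edge_set_def by metis
  next
    case False
    then have "degree_in d (S \<inter> A) x = 0" using dA by (intro degree_in_eq_0) blast
    then show ?thesis by simp
  qed
  moreover have "even (degree_in d (S \<inter> A) v)"
  \<comment> \<open>If there is no other vertex to compare with, \<open>A\<close> is empty, since an
    edge has two ends.\<close>
  proof (cases "VA = {v}")
    case True
    have "e \<notin> A" for e using dA[of e] True by (metis card_mono finA(2) is_singletonI is_singleton_altdef
          not_less_eq_eq numeral_2_eq_2 order_refl One_nat_def)
    then show ?thesis by (simp add: degree_in_def)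
  next
    case False
    then obtain u where "u \<in> VA" "u \<noteq> v" using V by blast
    then show ?thesis
      using even_degree_in_transfer[OF fin finA(2), of d u v] dA V ev' by blast
  qed
  ultimately show ?thesis unfolding even_edge_set_def by metis
qed

text \<open>The situation is symmetric, so facts about \<open>A\<close> hold for \<open>B\<close>
  too.\<close>

sublocale swap: vertex_join d B A VB VA v
  using finA finB AB V dA dB by unfold_locales auto

text \<open>Both parts of an even monochromatic set are even and monochromatic, hence empty.\<close>

lemma acyclic_coloring_join:
  assumes S: "A' \<subseteq> A" "B' \<subseteq> B" and c: "acyclic_coloring A' d c" "acyclic_coloring B' d c"
  shows "acyclic_coloring (A' \<union> B') d c"
  unfolding acyclic_coloring_def
proof (intro allI impI)
  fix S assume *: "S \<subseteq> A' \<union> B'" "(\<forall>e\<in>S. monochromatic c (d e)) \<and> even_edge_set d S"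
  then have "S \<subseteq> A \<union> B" "S \<subseteq> B \<union> A" using S by auto
  then have ev: "even_edge_set d (S \<inter> A)" "even_edge_set d (S \<inter> B)"
    using even_edge_set_left swap.even_edge_set_left *(2) by auto
  have "S \<inter> A \<subseteq> A'" "S \<inter> B \<subseteq> B'" using * S AB by auto
  then have "S \<inter> A = {}" "S \<inter> B = {}"
    using c ev *(2) unfolding acyclic_coloring_def by (meson IntD1)+
  then show "S = {}" using \<open>S \<subseteq> A \<union> B\<close> by blast
qed

text \<open>A cycle through \<open>f\<close> contains a path from \<open>u1\<close> to \<open>v\<close> inside \<open>A'\<close>, which \<open>e1\<close> closes up.\<close>

lemma acyclic_coloring_join_insert:
  assumes S: "A' \<subseteq> A" "B' \<subseteq> B" and f: "f \<notin> A \<union> B" "d f = {u1, u2}"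
    and u: "u1 \<in> VA - {v}" "u2 \<in> VB - {v}"
    and e1: "e1 \<in> A - A'" "d e1 = {u1, v}" and cu: "c u1 = c v"
    and c: "acyclic_coloring (insert e1 A') d c" "acyclic_coloring B' d c"
  shows "acyclic_coloring (insert f (A' \<union> B')) d c"
  unfolding acyclic_coloring_def
proof (intro allI impI)
  fix S assume *: "S \<subseteq> insert f (A' \<union> B')" "(\<forall>e\<in>S. monochromatic c (d e)) \<and> even_edge_set d S"
  show "S = {}"
  proof (cases "f \<in> S")
    case False
    have "acyclic_coloring (A' \<union> B') d c"
      using acyclic_coloring_join[OF S] c acyclic_coloring_mono by (meson subset_insertI)
    then show ?thesis using * False unfolding acyclic_coloring_def by blast
  next
    case True
    define S' where "S' = S - {f}"
    define T where "T = S' \<inter> A"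
    have S': "S' \<subseteq> A' \<union> B'" "S' \<subseteq> A \<union> B" "S = insert f S'" "f \<notin> S'"
      using * True S unfolding S'_def by auto
    have T: "T \<subseteq> A'" "e1 \<notin> T" "finite T" using S' S AB e1 finA unfolding T_def by auto
    have finS': "finite S'" using S'(2) finA finB by (meson finite_UnI finite_subset)
    have degS: "degree_in d S x = degree_in d S' x + (if x \<in> {u1, u2} then 1 else 0)" for x
      using degree_in_insert[OF finS' S'(4)] f(2) S'(3) by metis
    have ev: "even (degree_in d S x)" for x using *(2) unfolding even_edge_set_def by blast
    have degT: "degree_in d T x = degree_in d S' x" if "x \<in> VA" "x \<noteq> v" for x
      using degree_in_left[OF S'(2) that] unfolding T_def .
    have other: "even (degree_in d T x)" if "x \<in> VA" "x \<noteq> u1" "x \<noteq> v" for x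
    proof -
      have "x \<noteq> u2" using that u V by blast
      then show ?thesis using degT degS[of x] ev[of x] that by simp
    qed
    \<comment> \<open>The edge \<open>f\<close> accounts for one edge at \<open>u1\<close>, so
      \<open>T\<close> has odd degree there, and by the handshake lemma also at \<open>v\<close>.
      Adding \<open>e1\<close> repairs both parities.\<close>
    have "odd (degree_in d T u1)" using degT[of u1] degS[of u1] ev[of u1] u by simp
    moreover from this have "odd (degree_in d T v)"
      using even_degree_in_transfer[OF T(3) finA(2), of d u1 v] dA other u V T_def by blast
    moreover have "degree_in d T x = 0" if "x \<notin> VA" for x
      using that dA T S by (intro degree_in_eq_0) blast
    ultimately have "even_edge_set d (insert e1 T)"
      unfolding even_edge_set_def degree_in_insert[OF T(3,2)] e1(2)
      using other u V by fastforce
    \<comment> \<open>The assumption \<open>cu\<close> makes \<open>e1\<close> itself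
      monochromatic.\<close>
    moreover have "\<forall>e \<in> insert e1 T. monochromatic c (d e)"
      using e1(2) cu * unfolding T_def S'_def by auto
    ultimately have False using c(1) T(1) unfolding acyclic_coloring_def
      by (meson insert_mono insert_not_empty)
    then show ?thesis ..
  qed
qed

text \<open>Agreement at the only common vertex lets the glued coloring restrict to
  \<open>c1\<close> on \<open>VA\<close> and to \<open>c2\<close> on \<open>VB\<close>.\<close>

lemma combine_colorings:
  assumes "\<forall>x. c1 x < k" "\<forall>x. c2 x < k" "c1 v = c2 v"
  obtains c where "\<forall>x. c x < k"
    "\<And>E. E \<subseteq> A \<Longrightarrow> acyclic_coloring E d c \<longleftrightarrow> acyclic_coloring E d c1"
    "\<And>E. E \<subseteq> B \<Longrightarrow> acyclic_coloring E d c \<longleftrightarrow> acyclic_coloring E d c2"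
    "\<And>x. x \<in> VA \<Longrightarrow> c x = c1 x" "\<And>x. x \<in> VB \<Longrightarrow> c x = c2 x"
proof
  let ?c = "\<lambda>x. if x \<in> VA then c1 x else c2 x"
  show "\<forall>x. ?c x < k" using assms by auto
  show A: "\<And>x. x \<in> VA \<Longrightarrow> ?c x = c1 x" by simp
  show B: "\<And>x. x \<in> VB \<Longrightarrow> ?c x = c2 x" using V assms(3) by auto
  show "acyclic_coloring E d ?c \<longleftrightarrow> acyclic_coloring E d c1" if "E \<subseteq> A" for E
    using that dA by (intro acyclic_coloring_cong refl A) blast
  show "acyclic_coloring E d ?c \<longleftrightarrow> acyclic_coloring E d c2" if "E \<subseteq> B" for E
    using that dB by (intro acyclic_coloring_cong refl B) blast
qed

end

text \<open>A transposition of colors brings \<open>v\<close> to a prescribed color, so that two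
  colorings can be made to agree at \<open>v\<close> before they are glued.\<close>

lemma acyclic_coloring_recolor:
  assumes "acyclic_coloring E d c" "\<forall>x. c x < k" "i < k"
  obtains c' where "acyclic_coloring E d c'" "\<forall>x. c' x < (k::nat)" "c' v = i"
    "\<And>x. c' x = c' v \<longleftrightarrow> c x = c v"
proof
  let ?p = "transpose (c v) i"
  show "acyclic_coloring E d (?p \<circ> c)" using assms(1) acyclic_coloring_inj[of ?p E d c] by simp
  show "\<forall>x. (?p \<circ> c) x < k" using assms by (simp add: transpose_def)
  show "(?p \<circ> c) v = i" by simp
  show "(?p \<circ> c) x = (?p \<circ> c) v \<longleftrightarrow> c x = c v" for x by (simp add: transpose_def)
qed

section \<open>The two-edge join\<close>

text \<open>Here \<open>A\<close> and \<open>B\<close> are the original edge sets, still containing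
  \<open>E1\<close> and \<open>E2\<close>, which are removed only in \<open>joined\<close>;
  \<open>d\<close> describes old and new edges alike.\<close>

locale two_join = vertex_join +
  fixes u1 u2 E1 E2 F
  assumes u1: "u1 \<in> VA" "u1 \<noteq> v" and u2: "u2 \<in> VB" "u2 \<noteq> v"
    and E1: "E1 \<subseteq> A" "card E1 = 2" "\<And>e. e \<in> E1 \<Longrightarrow> d e = {u1, v}"
    and E2: "E2 \<subseteq> B" "card E2 = 2" "\<And>e. e \<in> E2 \<Longrightarrow> d e = {u2, v}"
    and F: "F \<inter> (A \<union> B) = {}" "card F = 2" "\<And>e. e \<in> F \<Longrightarrow> d e = {u1, u2}"
begin

abbreviation "joined \<equiv> (A - E1) \<union> (B - E2) \<union> F"

lemma colorable_joined:
  assumes k: "k \<ge> 3" and "colorable A d k" "colorable B d k"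
  shows "colorable joined d k"
proof -
  obtain c1 c2 where c: "\<forall>x. c1 x < k" "acyclic_coloring A d c1"
    "\<forall>x. c2 x < k" "acyclic_coloring B d c2" using assms unfolding colorable_def by blast
  obtain b1 where b1: "acyclic_coloring A d b1" "\<forall>x. b1 x < k" "b1 v = 0"
    using acyclic_coloring_recolor[OF c(2,1), of 0] k by (metis less_le_trans zero_less_numeral)
  obtain b2 where b2: "acyclic_coloring B d b2" "\<forall>x. b2 x < k" "b2 v = 0"
    using acyclic_coloring_recolor[OF c(4,3), of 0] k by (metis less_le_trans zero_less_numeral)
  have n1: "b1 u1 \<noteq> 0" using acyclic_coloring_parallel[OF b1(1) E1] b1(3) by simp
  have n2: "b2 u2 \<noteq> 0" using acyclic_coloring_parallel[OF b2(1) E2] b2(3) by simp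
  \<comment> \<open>A third color for \<open>u2\<close>, different from those of \<open>v\<close>
    and \<open>u1\<close>; this is where \<open>k \<ge> 3\<close> enters.\<close>
  obtain j where j: "j < k" "j \<noteq> 0" "j \<noteq> b1 u1"
  proof (cases "b1 u1 = 1")
    case True
    then show thesis using that[of 2] k by auto
  next
    case False
    then show thesis using that[of 1] k by auto
  qed
  \<comment> \<open>Moves \<open>u2\<close> to color \<open>j\<close> and leaves \<open>v\<close> at
    color 0, since neither transposed color is 0.\<close>
  let ?p = "transpose (b2 u2) j"
  let ?b = "?p \<circ> b2"
  have b: "acyclic_coloring B d ?b" using b2(1) acyclic_coloring_inj[of ?p B d b2] by simp
  have lt: "\<forall>x. ?b x < k" using b2(2) j by (simp add: transpose_def)
  have "b1 v = ?b v" using b1(3) b2(3) n2 j by (simp add: transpose_def)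
  then obtain c where c: "\<forall>x. c x < k"
    "\<And>E. E \<subseteq> A \<Longrightarrow> acyclic_coloring E d c \<longleftrightarrow> acyclic_coloring E d b1"
    "\<And>E. E \<subseteq> B \<Longrightarrow> acyclic_coloring E d c \<longleftrightarrow> acyclic_coloring E d ?b"
    "\<And>x. x \<in> VA \<Longrightarrow> c x = b1 x" "\<And>x. x \<in> VB \<Longrightarrow> c x = ?b x"
    using combine_colorings[OF b1(2) lt] by blast
  have "acyclic_coloring (A \<union> B) d c" using acyclic_coloring_join c b1 b by blast
  then have "acyclic_coloring ((A - E1) \<union> (B - E2)) d c" by (rule acyclic_coloring_mono) auto
  moreover have "\<not> monochromatic c (d e)" if "e \<in> F" for e
    using F(3)[OF that] c(4)[OF u1(1)] c(5)[OF u2(1)] j by simp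
  ultimately have "acyclic_coloring joined d c" by (rule acyclic_coloring_add_bichromatic)
  then show ?thesis using c(1) unfolding colorable_def by blast
qed

lemma acyclic_coloring_left:
  assumes "acyclic_coloring (A - E1) d c" "c u1 \<noteq> c v"
  shows "acyclic_coloring A d c"
proof -
  have "acyclic_coloring ((A - E1) \<union> E1) d c"
    using assms E1 by (intro acyclic_coloring_add_bichromatic) auto
  moreover have "(A - E1) \<union> E1 = A" using E1 by auto
  ultimately show ?thesis by simp
qed

text \<open>Otherwise \<open>E1\<close> would be bichromatic and could be put back.\<close>

lemma same_color:
  assumes "\<not> colorable A d k" "\<forall>x. c x < k" "acyclic_coloring (A - E1) d c"
  shows "c u1 = c v"
  using assms acyclic_coloring_left unfolding colorable_def by blast

text \<open>Only one of the two parallel edges is deleted. The kept edge \<open>e1\<close> certifies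
  that no monochromatic path joins \<open>u1\<close> to \<open>v\<close> in
  \<open>A - E1\<close>.\<close>

lemma minus_parallel_coloring:
  assumes "\<not> colorable A d k" "\<And>e. e \<in> A \<Longrightarrow> colorable (A - {e}) d k"
  obtains e1 c where "e1 \<in> E1" "\<forall>x. c x < k" "acyclic_coloring (insert e1 (A - E1)) d c"
    "acyclic_coloring (A - E1) d c" "c u1 = c v"
proof -
  obtain e e1 where e: "E1 = {e, e1}" "e \<noteq> e1" using E1(2) by (meson card_2_iff)
  then obtain c where c: "\<forall>x. c x < k" "acyclic_coloring (A - {e}) d c"
    using assms(2)[of e] E1 unfolding colorable_def by blast
  have "insert e1 (A - E1) = A - {e}" using e E1(1) by auto
  then have 1: "acyclic_coloring (insert e1 (A - E1)) d c" using c by simp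
  then have 2: "acyclic_coloring (A - E1) d c" by (rule acyclic_coloring_mono) auto
  show thesis using that[OF _ c(1) 1 2] same_color[OF assms(1) c(1) 2] e by blast
qed

sublocale swap2: two_join d B A VB VA v u2 u1 E2 E1 F
  using u1 u2 E1 E2 F by unfold_locales auto

lemma colorable_joinedD:
  assumes "colorable joined d k"
  shows "colorable A d k \<or> colorable B d k"
proof -
  obtain c where c: "\<forall>x. c x < k" "acyclic_coloring joined d c"
    using assms unfolding colorable_def by blast
  have "c u1 \<noteq> c u2" using acyclic_coloring_parallel[OF c(2) _ F(2,3)] by blast
  then have "c u1 \<noteq> c v \<or> c u2 \<noteq> c v" by auto
  moreover have "acyclic_coloring (A - E1) d c" "acyclic_coloring (B - E2) d c"
    using c(2) by (auto elim!: acyclic_coloring_mono)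
  ultimately show ?thesis
    using acyclic_coloring_left swap2.acyclic_coloring_left c(1) unfolding colorable_def by blast
qed

lemma colorable_joined_minus_left:
  assumes n: "\<not> colorable A d k" "\<not> colorable B d k"
    and B: "\<And>e. e \<in> B \<Longrightarrow> colorable (B - {e}) d k"
    and e: "e \<in> A - E1" "colorable (A - {e}) d k"
  shows "colorable (joined - {e}) d k"
proof -
  obtain c1 where c1: "\<forall>x. c1 x < k" "acyclic_coloring (A - {e}) d c1"
    using e unfolding colorable_def by blast
  \<comment> \<open>Both edges of \<open>E1\<close> survive the deletion of
    \<open>e\<close>.\<close>
  have n1: "c1 u1 \<noteq> c1 v"
    using acyclic_coloring_parallel[OF c1(2) _ E1(2,3)] E1(1) e(1) by blast
  obtain c2 where c2: "\<forall>x. c2 x < k" "acyclic_coloring (B - E2) d c2" "c2 u2 = c2 v"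
    using swap2.minus_parallel_coloring[OF n(2) B] by blast
  obtain b2 where b2: "acyclic_coloring (B - E2) d b2" "\<forall>x. b2 x < k" "b2 v = c1 v" "b2 u2 = b2 v"
    using acyclic_coloring_recolor[OF c2(2,1), of "c1 v" v] c1(1) c2(3) by metis
  obtain c where c: "\<forall>x. c x < k"
    "\<And>E. E \<subseteq> A \<Longrightarrow> acyclic_coloring E d c \<longleftrightarrow> acyclic_coloring E d c1"
    "\<And>E. E \<subseteq> B \<Longrightarrow> acyclic_coloring E d c \<longleftrightarrow> acyclic_coloring E d b2"
    "\<And>x. x \<in> VA \<Longrightarrow> c x = c1 x" "\<And>x. x \<in> VB \<Longrightarrow> c x = b2 x"
    using combine_colorings[OF c1(1) b2(2)] b2(3) by metis
  have "acyclic_coloring ((A - {e}) \<union> (B - E2)) d c"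
    using acyclic_coloring_join[of "A - {e}" "B - E2" c] c c1(2) b2(1) by blast
  \<comment> \<open>In \<open>c\<close> the vertex \<open>u2\<close> has the color of
    \<open>v\<close>, and \<open>u1\<close> does not.\<close>
  moreover have "\<not> monochromatic c (d f)" if "f \<in> F" for f
    using F(3)[OF that] c(4)[OF u1(1)] c(5)[OF u2(1)] n1 b2 by simp
  ultimately have "acyclic_coloring ((A - {e}) \<union> (B - E2) \<union> F) d c"
    by (rule acyclic_coloring_add_bichromatic)
  then have "acyclic_coloring (joined - {e}) d c" by (rule acyclic_coloring_mono) auto
  then show ?thesis using c(1) unfolding colorable_def by blast
qed

end

context two_join
begin

text \<open>The remaining new edge may be monochromatic, but a cycle through it would need a path
  from \<open>u1\<close> to \<open>v\<close> on the left, which \<open>e1\<close> excludes. On the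
  right any coloring that agrees at \<open>v\<close> will do.\<close>

lemma colorable_joined_minus_new:
  assumes n: "\<not> colorable A d k" "\<not> colorable B d k"
    and A: "\<And>e. e \<in> A \<Longrightarrow> colorable (A - {e}) d k"
    and B: "\<And>e. e \<in> B \<Longrightarrow> colorable (B - {e}) d k"
    and e: "e \<in> F"
  shows "colorable (joined - {e}) d k"
proof -
  have "card (F - {e}) = 1" using F(2) e by simp
  then obtain f where f: "F - {e} = {f}" "f \<in> F" by (auto simp: card_1_singleton_iff)
  obtain e1 c1 where e1: "e1 \<in> E1" and c1: "\<forall>x. c1 x < k" "acyclic_coloring (insert e1 (A - E1)) d c1"
    "c1 u1 = c1 v" using minus_parallel_coloring[OF n(1) A] by blast
  obtain c2 where c2: "\<forall>x. c2 x < k" "acyclic_coloring (B - E2) d c2"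
    using swap2.minus_parallel_coloring[OF n(2) B] by blast
  obtain b2 where b2: "acyclic_coloring (B - E2) d b2" "\<forall>x. b2 x < k" "b2 v = c1 v"
    using acyclic_coloring_recolor[OF c2(2,1), of "c1 v" v] c1(1) by metis
  obtain c where c: "\<forall>x. c x < k"
    "\<And>E. E \<subseteq> A \<Longrightarrow> acyclic_coloring E d c \<longleftrightarrow> acyclic_coloring E d c1"
    "\<And>E. E \<subseteq> B \<Longrightarrow> acyclic_coloring E d c \<longleftrightarrow> acyclic_coloring E d b2"
    "\<And>x. x \<in> VA \<Longrightarrow> c x = c1 x" "\<And>x. x \<in> VB \<Longrightarrow> c x = b2 x"
    using combine_colorings[OF c1(1) b2(2)] b2(3) by metis
  have "acyclic_coloring (insert f ((A - E1) \<union> (B - E2))) d c"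
  proof (rule acyclic_coloring_join_insert)
    show "A - E1 \<subseteq> A" "B - E2 \<subseteq> B" by auto
    show "f \<notin> A \<union> B" "d f = {u1, u2}" using f F by auto
    show "u1 \<in> VA - {v}" "u2 \<in> VB - {v}" using u1 u2 by auto
    show "e1 \<in> A - (A - E1)" "d e1 = {u1, v}" using e1 E1 by auto
    have "v \<in> VA" using V by blast
    then show "c u1 = c v" using c(4) u1(1) c1(3) by simp
    have "insert e1 (A - E1) \<subseteq> A" using e1 E1 by auto
    then show "acyclic_coloring (insert e1 (A - E1)) d c" using c(2) c1(2) by blast
    show "acyclic_coloring (B - E2) d c" using c(3) b2(1) by blast
  qed
  moreover have "joined - {e} \<subseteq> insert f ((A - E1) \<union> (B - E2))" using f(1) by blast
  ultimately have "acyclic_coloring (joined - {e}) d c" by (rule acyclic_coloring_mono)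
  then show ?thesis using c(1) unfolding colorable_def by blast
qed

lemma colorable_joined_minus:
  assumes n: "\<not> colorable A d k" "\<not> colorable B d k"
    and A: "\<And>e. e \<in> A \<Longrightarrow> colorable (A - {e}) d k"
    and B: "\<And>e. e \<in> B \<Longrightarrow> colorable (B - {e}) d k"
    and e: "e \<in> joined"
  shows "colorable (joined - {e}) d k"
proof -
  consider "e \<in> A - E1" | "e \<in> B - E2" | "e \<in> F" using e by blast
  then show ?thesis
  proof cases
    case 1
    then show ?thesis using colorable_joined_minus_left[OF n B] A by blast
  next
    case 2
    then have "colorable ((B - E2) \<union> (A - E1) \<union> F - {e}) d k"
      using swap2.colorable_joined_minus_left[OF n(2,1) A] B by blast
    then show ?thesis by (simp add: Un_commute)
  next
    case 3
    then show ?thesis using colorable_joined_minus_new[OF n A B] by blast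
  qed
qed

text \<open>Otherwise \<open>v\<close> could be given a color different from that of \<open>u1\<close>.\<close>

lemma join_vertex_incident:
  assumes k: "k \<ge> 2" and n: "\<not> colorable A d k" and A: "\<And>e. e \<in> A \<Longrightarrow> colorable (A - {e}) d k"
  shows "\<exists>e \<in> A - E1. v \<in> d e"
proof (rule ccontr)
  assume no: "\<not> ?thesis"
  obtain c where c: "\<forall>x. c x < k" "acyclic_coloring (A - E1) d c"
    using minus_parallel_coloring[OF n A] by blast
  \<comment> \<open>A color other than that of \<open>u1\<close>, available by
    \<open>k \<ge> 2\<close>. Recoloring \<open>v\<close> is free because no edge of
    \<open>A - E1\<close> contains it.\<close>
  let ?i = "if c u1 = 0 then 1 else 0 :: nat"
  let ?c = "c(v := ?i)"
  have "acyclic_coloring (A - E1) d ?c"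
    using c(2) no by (subst acyclic_coloring_cong[of _ d d _ c]) auto
  moreover have "?c u1 \<noteq> ?c v" using u1 by auto
  ultimately have "acyclic_coloring A d ?c" by (rule acyclic_coloring_left)
  moreover have "\<forall>x. ?c x < k" using c(1) k by auto
  ultimately show False using n unfolding colorable_def by blast
qed

end

section \<open>The Hajos join as an instance of the two-edge join\<close>

theorem theorem14:
  fixes G1 G2 G :: "('v, 'e) mgraph" and k :: nat
  assumes "multigraph G1" and "multigraph G2"
    and "verts G1 \<noteq> {}" and "verts G2 \<noteq> {}"
    and "disjoint_graphs G1 G2"
    and "hajos_2_join G1 G2 G"
  shows "(chi2 G1 = k \<and> chi2 G2 = k \<and> k \<ge> 3 \<longrightarrow> chi2 G = k) \<and>
         (G1 \<in> Cri2 k \<and> G2 \<in> Cri2 k \<and> k \<ge> 3 \<longrightarrow> G \<in> Cri2 k)"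
proof -
  obtain u1 v1 E1 u2 v2 E2 F where
    p1: "two_parallel_edges G1 u1 v1 E1" and p2: "two_parallel_edges G2 u2 v2 E2"
    and F0: "card F = 2" "F \<inter> (edges G1 \<union> edges G2) = {}"
    and G: "G = add_edges (identify (delete_edges (graph_union G1 G2) (E1 \<union> E2)) v1 v2) F u1 u2"
    using assms(6) unfolding hajos_2_join_def by blast
  let ?f = "\<lambda>x. if x = v2 then v1 else x"
  let ?d = "ends G"
  have q1: "u1 \<in> verts G1" "v1 \<in> verts G1" "u1 \<noteq> v1" "E1 \<subseteq> edges G1" "card E1 = 2"
      "\<And>e. e \<in> E1 \<Longrightarrow> ends G1 e = {u1, v1}"
    using p1 unfolding two_parallel_edges_def by auto
  have q2: "u2 \<in> verts G2" "v2 \<in> verts G2" "u2 \<noteq> v2" "E2 \<subseteq> edges G2" "card E2 = 2"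
      "\<And>e. e \<in> E2 \<Longrightarrow> ends G2 e = {u2, v2}"
    using p2 unfolding two_parallel_edges_def by auto
  have dis: "verts G1 \<inter> verts G2 = {}" "edges G1 \<inter> edges G2 = {}"
    using assms(5) unfolding disjoint_graphs_def by auto
  have m1: "finite (verts G1)" "finite (edges G1)"
      "\<And>e. e \<in> edges G1 \<Longrightarrow> ends G1 e \<subseteq> verts G1 \<and> card (ends G1 e) = 2"
    using assms(1) unfolding multigraph_def by auto
  have m2: "finite (verts G2)" "finite (edges G2)"
      "\<And>e. e \<in> edges G2 \<Longrightarrow> ends G2 e \<subseteq> verts G2 \<and> card (ends G2 e) = 2"
    using assms(2) unfolding multigraph_def by auto
  have f1: "?f ` X = X" if "X \<subseteq> verts G1" for X
  proof -
    have "v2 \<notin> X" using that q2(2) dis(1) by blast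
    then have "?f ` X = id ` X" by (intro image_cong) auto
    then show ?thesis by simp
  qed
  \<comment> \<open>The identification fixes \<open>verts G1\<close>, and on \<open>verts G2\<close>
    it only renames \<open>v2\<close> to \<open>v1\<close>, which is not a vertex of
    \<open>G2\<close>.\<close>
  have inj: "inj_on ?f (verts G2)" using q1(2) dis(1) by (auto simp: inj_on_def)
  have dG1: "?d e = ends G1 e" if "e \<in> edges G1" for e
  proof -
    have "?d e = ?f ` ends G1 e"
      using that F0(2) unfolding G add_edges_def identify_def delete_edges_def graph_union_def Let_def
      by auto
    also have "\<dots> = ends G1 e" using m1(3)[OF that] by (intro f1) blast
    finally show ?thesis .
  qed
  have dG2: "?d e = ?f ` ends G2 e" if "e \<in> edges G2" for e
    using that F0(2) dis(2)
    unfolding G add_edges_def identify_def delete_edges_def graph_union_def Let_def by auto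
  have dF: "?d e = {u1, u2}" if "e \<in> F" for e using that unfolding G add_edges_def by simp
  have vG: "verts G = verts G1 \<union> ?f ` verts G2"
  proof -
    have "verts G = ?f ` (verts G1 \<union> verts G2)"
      unfolding G add_edges_def identify_def delete_edges_def graph_union_def Let_def by simp
    then show ?thesis by (simp only: image_Un f1[OF subset_refl])
  qed
  have eG: "edges G = (edges G1 - E1) \<union> (edges G2 - E2) \<union> F"
    using dis(2) q1(4) q2(4)
    unfolding G add_edges_def identify_def delete_edges_def graph_union_def Let_def by auto
  have V: "verts G1 \<inter> ?f ` verts G2 = {v1}" using dis(1) q1(2) q2(2) by auto
  \<comment> \<open>Although \<open>E1\<close> and \<open>E2\<close> are not edges of
    \<open>G\<close>, \<open>ends G\<close> still gives their ends, because
    \<open>delete_edges\<close> leaves \<open>ends\<close> unchanged. So it can serve for both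
    original graphs.\<close>
  interpret two_join ?d "edges G1" "edges G2" "verts G1" "?f ` verts G2" v1 u1 u2 E1 E2 F
  proof
    show "?d e \<subseteq> verts G1 \<and> card (?d e) = 2" if "e \<in> edges G1" for e
      using m1(3) dG1 that by simp
    show "?d e \<subseteq> ?f ` verts G2 \<and> card (?d e) = 2" if "e \<in> edges G2" for e
    proof -
      have "card (?f ` ends G2 e) = 2" using m2(3)[OF that] inj_on_subset[OF inj] by (simp only: card_image)
      then show ?thesis unfolding dG2[OF that] using m2(3)[OF that] by (blast intro: image_mono)
    qed
    show "u2 \<in> ?f ` verts G2" using q2(1,3) by (intro image_eqI[of _ _ u2]) auto
    show "u2 \<noteq> v1" using q2(1) q1(2) dis(1) by auto
    show "?d e = {u1, v1}" if "e \<in> E1" for e using that q1(4,6) dG1 by auto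
    show "?d e = {u2, v1}" if "e \<in> E2" for e
    proof -
      have "?d e = ?f ` {u2, v2}" using that q2(4,6) dG2 by (metis subsetD)
      then show ?thesis using q2(3) by auto
    qed
    show "finite (?f ` verts G2)" using m2(1) by simp
    show "verts G1 \<inter> ?f ` verts G2 = {v1}" by (fact V)
    show "F \<inter> (edges G1 \<union> edges G2) = {}" by (fact F0)
  qed (fact m1 m2 dis q1 q2 F0 dF)+
  have mG: "multigraph G"
  proof -
    have "finite F" using F0(1) by (intro card_ge_0_finite) simp
    moreover have "u1 \<noteq> u2" using q1(1) q2(1) dis(1) by auto
    then have "?d e \<subseteq> verts G \<and> card (?d e) = 2" if "e \<in> edges G" for e
      using that dA[of e] dB[of e] dF[of e] u1 u2 unfolding eG vG by auto
    ultimately show ?thesis using m1 m2 unfolding multigraph_def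
      by (auto simp: eG vG)
  qed
  have c1: "colorable E ?d j \<longleftrightarrow> colorable E (ends G1) j" if "E \<subseteq> edges G1" for E j
    using that dG1 by (intro colorable_cong) auto
  have c2: "colorable E ?d j \<longleftrightarrow> colorable E (ends G2) j" if E: "E \<subseteq> edges G2" for E j
  proof -
    have "colorable E ?d j \<longleftrightarrow> colorable E (\<lambda>e. ?f ` ends G2 e) j"
      using E dG2 by (intro colorable_cong) auto
    also have "\<dots> \<longleftrightarrow> colorable E (ends G2) j"
      using E m2(3) by (intro colorable_rename[OF inj]) blast
    finally show ?thesis .
  qed
  have a: "chi2 G = k" if "chi2 G1 = k" "chi2 G2 = k" "k \<ge> 3"
  proof -
    have k2: "k \<ge> 2" using that by simp
    show ?thesis
      \<comment> \<open>The upper bound is \<open>colorable_joined\<close> for \<open>k\<close>, the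
        lower bound \<open>colorable_joinedD\<close> for \<open>k - 1\<close>.\<close>
      using that chi2_eq_iff[OF assms(1) k2] chi2_eq_iff[OF assms(2) k2] chi2_eq_iff[OF mG k2]
        colorable_joined[OF that(3)] colorable_joinedD[of "k - 1"] c1 c2 eG by auto
  qed
  have b: "G \<in> Cri2 k" if C: "G1 \<in> Cri2 k" "G2 \<in> Cri2 k" "k \<ge> 3"
  proof (rule Cri2I)
    \<comment> \<open>The second bound provides the two colors needed to recolor the identified
      vertex.\<close>
    have k2: "k \<ge> 2" "k - 1 \<ge> 2" using C by auto
    have chi: "chi2 G1 = k" "chi2 G2 = k" using C unfolding Cri2_def by auto
    then have n: "\<not> colorable (edges G1) ?d (k - 1)" "\<not> colorable (edges G2) ?d (k - 1)"
      using chi2_eq_iff[OF assms(1) k2(1)] chi2_eq_iff[OF assms(2) k2(1)] c1 c2 by auto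
    have A: "colorable (edges G1 - {e}) ?d (k - 1)" if "e \<in> edges G1" for e
      using Cri2_colorable_delete_edge[OF C(1) k2(1) that] c1 by auto
    have B: "colorable (edges G2 - {e}) ?d (k - 1)" if "e \<in> edges G2" for e
      using Cri2_colorable_delete_edge[OF C(2) k2(1) that] c2 by auto
    show "multigraph G" "k \<ge> 2" by (fact mG, fact k2)
    show "chi2 G = k" using a chi C by blast
    show "colorable (edges G - {e}) ?d (k - 1)" if "e \<in> edges G" for e
      using colorable_joined_minus[OF n A B] that unfolding eG by blast
    show "\<exists>e \<in> edges G. x \<in> ?d e" if x: "x \<in> verts G" for x
    proof -
      obtain f where f: "f \<in> F" using F0(1) by fastforce
      have v: "\<exists>e \<in> edges G. v1 \<in> ?d e"
        using join_vertex_incident[OF k2(2) n(1) A] unfolding eG by blast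
      have u: "\<exists>e \<in> edges G. u1 \<in> ?d e" "\<exists>e \<in> edges G. u2 \<in> ?d e"
        using f dF[OF f] unfolding eG by auto
      \<comment> \<open>The vertices that lose edges are treated separately. Every other vertex
        keeps all its edges, and \<open>v2\<close> does not occur since it is called
        \<open>v1\<close> in \<open>G\<close>.\<close>
      consider "x \<in> {v1, u1, u2}" | "x \<in> verts G1" "x \<notin> {v1, u1, u2}"
        | "x \<in> verts G2" "x \<notin> {v1, u1, u2}" "x \<noteq> v2"
        using x unfolding vG by (auto split: if_splits)
      then show ?thesis
      proof cases
        case 1
        then show ?thesis using u v by blast
      next
        case 2
        then obtain e where e: "e \<in> edges G1" "x \<in> ends G1 e"
          using Cri2_vertex_incident[OF C(1) k2(1)] by blast
        then have "e \<notin> E1" using q1(6) 2 by auto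
        then show ?thesis using e dG1 eG by blast
      next
        case 3
        then obtain e where e: "e \<in> edges G2" "x \<in> ends G2 e"
          using Cri2_vertex_incident[OF C(2) k2(1)] by blast
        then have "e \<notin> E2" using q2(6) 3 by auto
        moreover have "x \<in> ?d e" using dG2[OF e(1)] e(2) 3(3) by force
        ultimately show ?thesis using e eG by blast
      qed
    qed
  qed
  show ?thesis using a b by blast
qed

end
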